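(* For every positive integer $b$, there exists a positive integer $k$ such that the formula with reversal $$\phi_k = x_0x_1\cdot x_1x_2\cdot \ldots \cdot x_{k-2}x_{k-1}\cdot x_{k-1}x_0\cdot x_0^R\cdot x_1^R\cdot\ldots\cdot x_{k-1}^R$$ (on the $k$ variables $x_0,\dots,x_{k-1}$) satisfies $b<\lambda(\phi_k)\le k+1$.
   Context: A formula with reversal is a finite set of words (called fragments, written separated by dots) over an alphabet of variables, where each variable $x$ may occur either as $x$ or as $x^R$. An occurrence of a formula with reversal $F$ in a word $w$ is a map $h$ assigning to each variable a nonempty word, extended to fragments by concatenation with the convention $h(x^R)=h(x)^R$ (the reverse, i.e. mirror image, of $h(x)$), such that $h(f)$ is a factor of $w$ for every fragment $f$ of $F$. A (finite or infinite) word avoids $F$ if it contains no occurrence of $F$. The avoidability index $\lambda(F)$ is the minimum number of letters of an alphabet over which there exists an infinite word avoiding $F$ ($\lambda(F)=\infty$ if no such finite alphabet exists). *)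

theory Defs
  imports "HOL-Library.Omega_Words_Fun" "HOL-Library.Extended_Nat"
begin

datatype 'v symb = Var 'v | Rev 'v

type_synonym 'v fragment = "'v symb list"

text \<open>Formulas are finite sets of fragments; finiteness is not built into the type.\<close>
type_synonym 'v rformula = "'v fragment set"

fun subst_symb :: "('v \<Rightarrow> 'a list) \<Rightarrow> 'v symb \<Rightarrow> 'a list" where
  "subst_symb h (Var x) = h x"
| "subst_symb h (Rev x) = rev (h x)"

definition subst_fragment :: "('v \<Rightarrow> 'a list) \<Rightarrow> 'v fragment \<Rightarrow> 'a list" where
  "subst_fragment h f = concat (map (subst_symb h) f)"

definition factor :: "'a list \<Rightarrow> 'a word \<Rightarrow> bool" where
  "factor u w \<longleftrightarrow> (\<exists>i j. u = w [i \<rightarrow> j])"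

definition occurrence :: "('v \<Rightarrow> 'a list) \<Rightarrow> 'v rformula \<Rightarrow> 'a word \<Rightarrow> bool" where
  "occurrence h F w \<longleftrightarrow> (\<forall>x. h x \<noteq> []) \<and> (\<forall>f\<in>F. factor (subst_fragment h f) w)"

definition avoids :: "'a word \<Rightarrow> 'v rformula \<Rightarrow> bool" where
  "avoids w F \<longleftrightarrow> \<not> (\<exists>h. occurrence h F w)"

text \<open>Letters are taken from \<^typ>\<open>nat\<close>, which contains alphabets of every finite size. The
  infimum over an empty set is \<open>\<infinity>\<close>; over a nonempty set of extended naturals it is
  a minimum.\<close>
definition avoidability_index :: "'v rformula \<Rightarrow> enat" where
  "avoidability_index F =
     Inf {enat (card A) | A :: nat set. finite A \<and> (\<exists>w. range w \<subseteq> A \<and> avoids w F)}"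

definition phi :: "nat \<Rightarrow> nat rformula" where
  "phi k = {[Var i, Var ((i + 1) mod k)] | i. i < k} \<union> {[Rev i] | i. i < k}"

lemma finite_phi: "finite (phi k)"
  by (simp add: phi_def)

end

theory Submission imports Defs begin

text \<open>Upper bound: in the periodic word \<open>(0 1 \<dots> k)\<^sup>\<omega>\<close> only single letters have their
  reversal as a factor, so an occurrence of \<open>\<phi>\<^sub>k\<close> would be a closed walk of length \<open>k\<close> in a
  directed cycle of length \<open>k + 1\<close>. Lower bound: among any \<open>b + 1\<close> consecutive letters of a word
  over \<open>b\<close> letters two coincide, which gives a closed walk of some length \<open>c \<le> b\<close> in the graph of
  two-letter factors. If \<open>c\<close> divides \<open>k\<close>, running through this walk \<open>k / c\<close> times is
  an occurrence of \<open>\<phi>\<^sub>k\<close> by single letters; hence \<open>k\<close> may be any multiple of \<open>b!\<close>.\<close>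

lemma factor_adjacent:
  assumes "factor (u @ p # q # v) w"
  shows "\<exists>n. p = w n \<and> q = w (Suc n)"
proof -
  obtain i j where eq: "u @ p # q # v = map w [i..<j]"
    using assms by (auto simp: factor_def subsequence_def)
  have len: "length u + 2 + length v = j - i"
    using arg_cong[OF eq, of length] by simp
  have "p = w (i + length u)"
    using arg_cong[OF eq, of "\<lambda>xs. xs ! length u"] len by simp
  moreover have "q = w (Suc (i + length u))"
    using arg_cong[OF eq, of "\<lambda>xs. xs ! Suc (length u)"] len by (simp add: nth_append)
  ultimately show ?thesis by blast
qed

lemma factor_singleton: "factor [w n] w"
  unfolding factor_def by (intro exI[of _ n] exI[of _ "Suc n"]) simp

lemma factor_pair: "factor [w n, w (Suc n)] w"
  unfolding factor_def by (intro exI[of _ n] exI[of _ "Suc (Suc n)"]) (simp add: subsequence_def)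

lemma occurrence_phi_iff:
  "occurrence h (phi k) w \<longleftrightarrow>
     (\<forall>i. h i \<noteq> []) \<and>
     (\<forall>i<k. factor (h i @ h ((i + 1) mod k)) w \<and> factor (rev (h i)) w)"
proof -
  have phi: "phi k = (\<lambda>i. [Var i, Var ((i + 1) mod k)]) ` {..<k} \<union> (\<lambda>i. [Rev i]) ` {..<k}"
    by (auto simp: phi_def)
  show ?thesis
    unfolding occurrence_def phi by (auto simp: subst_fragment_def ball_Un)
qed

text \<open>For \<open>k = 1\<close> the word is 010101..., where \<open>h 0 = [0, 1]\<close> gives
  an occurrence; hence the bound on \<open>k\<close>.\<close>

lemma periodic_word_avoids_phi:
  assumes "k \<ge> 2"
  shows "avoids (\<lambda>n. n mod (k + 1)) (phi k)"
  unfolding avoids_def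
proof
  let ?w = "\<lambda>n. n mod (k + 1)"
  assume "\<exists>h. occurrence h (phi k) ?w"
  then obtain h where ne: "\<And>i. h i \<noteq> []"
    and fwd: "\<And>i. i < k \<Longrightarrow> factor (h i @ h ((i + 1) mod k)) ?w"
    and bwd: "\<And>i. i < k \<Longrightarrow> factor (rev (h i)) ?w"
    by (auto simp: occurrence_phi_iff)
  have adjacent: "q = (p + 1) mod (k + 1)" if f: "factor (u @ p # q # v) ?w" for u p q v
    using factor_adjacent[OF f] by (auto simp: mod_Suc_eq)
  \<comment> \<open>If a longer image starts with \<open>p q\<close>, its reversal ends with
    \<open>q p\<close>. Each letter is then the successor of the other, so \<open>k + 1\<close>
    divides 2, although it is at least 3.\<close>
  have single: "h i = [hd (h i)]" if i: "i < k" for i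
  proof (rule ccontr)
    assume "h i \<noteq> [hd (h i)]"
    then obtain p q r where pqr: "h i = p # q # r"
      using ne[of i] by (metis list.exhaust list.sel(1))
    have q: "q = (p + 1) mod (k + 1)"
      using adjacent[of "[]"] fwd[OF i] pqr by simp
    have p: "p = (q + 1) mod (k + 1)"
      using adjacent[of "rev r" q p "[]"] bwd[OF i] pqr by simp
    have "p < k + 1" "q < k + 1"
      by (subst p, simp) (subst q, simp)
    then have mods: "p mod Suc k = p" "q mod Suc k = q"
      by simp_all
    have "p = k \<and> q = 0 \<or> q = p + 1"
      using q by (simp add: mod_Suc mods split: if_splits)
    moreover have "q = k \<and> p = 0 \<or> p = q + 1"
      using p by (simp add: mod_Suc mods split: if_splits)
    ultimately show False
      using assms by linarith
  qed
  define g where "g i = hd (h i)" for i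
  have step: "g ((i + 1) mod k) = (g i + 1) mod (k + 1)" if i: "i < k" for i
  proof -
    have "(i + 1) mod k < k" using assms by simp
    then have "h ((i + 1) mod k) = [g ((i + 1) mod k)]" "h i = [g i]"
      using single i unfolding g_def by blast+
    then show ?thesis using fwd[OF i] adjacent[of "[]" "g i" "g ((i + 1) mod k)" "[]"] by simp
  qed
  \<comment> \<open>The \<open>mod\<close> on the left makes the base case trivial without a bound
    on \<open>g 0\<close>.\<close>
  have walk: "i < k \<Longrightarrow> g i mod (k + 1) = (g 0 + i) mod (k + 1)" for i
  proof (induction i)
    case (Suc i)
    have "g (Suc i) = (g i + 1) mod (k + 1)"
      using step[of i] Suc.prems by simp
    also have "\<dots> = (g 0 + i + 1) mod (k + 1)"
      using Suc by (intro mod_add_cong) simp_all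
    finally show ?case by simp
  qed simp
  have "g 0 = (g (k - 1) + 1) mod (k + 1)"
    using step[of "k - 1"] assms by simp
  also have "\<dots> = (g 0 + (k - 1) + 1) mod (k + 1)"
    using walk[of "k - 1"] assms by (intro mod_add_cong) simp_all
  also have "\<dots> = (g 0 + k) mod (k + 1)"
    using assms by simp
  finally have eq: "g 0 = (g 0 + k) mod (k + 1)" .
  show False
  \<comment> \<open>Adding \<open>k\<close> subtracts 1 modulo \<open>k + 1\<close>: 0 would become
    \<open>k\<close>, and \<open>Suc n\<close> at most \<open>n\<close>.\<close>
  proof (cases "g 0")
    case 0
    then show False using eq assms by simp
  next
    case (Suc n)
    then have "Suc n = (n + (k + 1)) mod (k + 1)" using eq by simp
    also have "\<dots> = n mod (k + 1)" by (rule mod_add_self2)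
    also have "\<dots> \<le> n" by (rule mod_less_eq_dividend)
    finally show False by simp
  qed
qed

lemma closed_walk_phi_occurrence:
  fixes w :: "'a word"
  assumes c: "0 < c" "c dvd k" and rep: "w i = w (i + c)"
  shows "\<exists>h. occurrence h (phi k) w"
proof
  show "occurrence (\<lambda>m. [w (i + m mod c)]) (phi k) w"
    unfolding occurrence_phi_iff
  proof (intro conjI allI impI)
    fix m
    \<comment> \<open>As \<open>c\<close> divides \<open>k\<close>, the wrap of indices from
      \<open>k - 1\<close> to 0 is also a wrap modulo \<open>c\<close>.\<close>
    have "(m + 1) mod k mod c = Suc m mod c"
      using c by (simp add: mod_mod_cancel)
    moreover have "w (i + Suc m mod c) = w (Suc (i + m mod c))"
    proof (cases "Suc (m mod c) = c")
      \<comment> \<open>At the end of the walk the next letter is \<open>w (i + c)\<close>, which is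
        \<open>w i\<close> again.\<close>
      case True
      then have "Suc (i + m mod c) = i + c" by simp
      moreover have "Suc m mod c = 0" using True by (simp add: mod_Suc)
      ultimately show ?thesis using rep by (simp only: add_0_right)
    qed (simp add: mod_Suc)
    ultimately show "factor ([w (i + m mod c)] @ [w (i + (m + 1) mod k mod c)]) w"
      using factor_pair[of w "i + m mod c"] by simp
  qed (simp_all add: factor_singleton)
qed

lemma small_alphabet_phi_occurrence:
  assumes "finite A" "card A \<le> b" "range w \<subseteq> A" "fact b dvd k"
  shows "\<exists>h. occurrence h (phi k) w"
proof -
  have "card (w ` {..b}) \<le> card A"
    using assms by (intro card_mono) auto
  then have "\<not> inj_on w {..b}"
    using assms(2) card_image[of w "{..b}"] by auto
  then obtain i j where "w i = w j" "i < j" "j \<le> b"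
    unfolding inj_on_def by (metis atMost_iff linorder_neqE_nat)
  moreover from this have "j - i dvd k"
    by (intro dvd_trans[OF dvd_fact assms(4)]) auto
  ultimately show ?thesis
    using closed_walk_phi_occurrence[of "j - i" k w i] by simp
qed

theorem theorem1:
  fixes b :: nat
  assumes "b \<ge> 1"
  shows "\<exists>k::nat. k \<ge> 1 \<and> enat b < avoidability_index (phi k)
           \<and> avoidability_index (phi k) \<le> enat (k + 1)"
proof (intro exI conjI)
  \<comment> \<open>The lower bound would allow \<open>fact b\<close>, but this is 1 for
    \<open>b = 1\<close>, while the upper bound needs \<open>k \<ge> 2\<close>.\<close>
  let ?k = "fact (b + 1) :: nat"
  have k: "?k \<ge> 2"
    using fact_ge_self[of "b + 1"] assms by linarith
  then show "?k \<ge> 1" by simp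
  have "fact b dvd ?k" by (intro fact_dvd) simp
  \<comment> \<open>\<open>Inf_greatest\<close> yields a weak inequality, so strictness is carried
    by \<open>Suc b\<close>.\<close>
  then have "enat (Suc b) \<le> avoidability_index (phi ?k)"
    unfolding avoidability_index_def avoids_def
    using small_alphabet_phi_occurrence[of _ b _ ?k]
    by (intro Inf_greatest) (fastforce simp: not_less_eq_eq[symmetric] simp del: fact_Suc)
  then show "enat b < avoidability_index (phi ?k)"
    by (rule less_le_trans[rotated]) simp
  show "avoidability_index (phi ?k) \<le> enat (?k + 1)"
    unfolding avoidability_index_def
  proof (rule Inf_lower, rule CollectI, intro exI conjI)
    show "enat (?k + 1) = enat (card {..?k})" by simp
    show "range (\<lambda>n. n mod (?k + 1)) \<subseteq> {..?k}"
      by (auto simp: less_Suc_eq_le[symmetric] simp del: fact_Suc)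
  qed (use periodic_word_avoids_phi[OF k] in simp_all)
qed

end
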